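(* Let $n<N$ and let $\tilde{\boldsymbol q}:\mathbb{R}^n\to\mathbb{R}^N$, $\tilde{\boldsymbol q}(\boldsymbol\theta)=\boldsymbol s_0+\boldsymbol V\boldsymbol\theta+\boldsymbol W(\boldsymbol\theta\otimes\boldsymbol\theta)$, be the nonlinear parametrization derived from a quadratic manifold whose matrices $\boldsymbol V\in\mathbb{R}^{N\times n}$ and $\boldsymbol W\in\mathbb{R}^{N\times n^2}$ are constructed from data with the greedy approach (as described in the context). Then for all $\boldsymbol\theta\in\mathbb{R}^n$ the Jacobian matrix $\boldsymbol J(\boldsymbol\theta)=\left[\frac{\partial \tilde q_i}{\partial\theta_j}(\boldsymbol\theta)\right]_{i=1,\dots,N,\;j=1,\dots,n}\in\mathbb{R}^{N\times n}$ of $\tilde{\boldsymbol q}$ has full column rank $n$, and thus, for all $\boldsymbol\theta\in\mathbb{R}^n$ and $\boldsymbol\mu\in\mathcal D$, the least-squares problem $$\min_{\boldsymbol\eta\in\mathbb{R}^n}\left\|\boldsymbol J(\boldsymbol\theta)\boldsymbol\eta-\boldsymbol f(\tilde{\boldsymbol q}(\boldsymbol\theta);\boldsymbol\mu)\right\|_2^2$$ has a unique solution.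
   Context: Full model: $\partial_t\boldsymbol q(t;\boldsymbol\mu)=\boldsymbol f(\boldsymbol q(t;\boldsymbol\mu);\boldsymbol\mu)$ is a semi-discrete system with state in $\mathbb{R}^N$, parameter $\boldsymbol\mu\in\mathcal D\subset\mathbb{R}^{d'}$, and right-hand side function $\boldsymbol f:\mathbb{R}^N\times\mathcal D\to\mathbb{R}^N$. Quadratic feature map: for $\hat{\boldsymbol s}\in\mathbb{R}^n$, $h(\hat{\boldsymbol s})=\hat{\boldsymbol s}\otimes\hat{\boldsymbol s}=[\hat s_1\hat s_1,\hat s_1\hat s_2,\dots,\hat s_1\hat s_n,\hat s_2\hat s_1,\dots,\hat s_n\hat s_n]^\top\in\mathbb{R}^{n^2}$ (Kronecker product). Quadratic manifold: given a reference point $\boldsymbol s_0\in\mathbb{R}^N$, the encoder is $e_{\boldsymbol V}(\boldsymbol s)=\boldsymbol V^\top(\boldsymbol s-\boldsymbol s_0)$ and the decoder is $g_{\boldsymbol V,\boldsymbol W}(\hat{\boldsymbol s})=\boldsymbol s_0+\boldsymbol V\hat{\boldsymbol s}+\boldsymbol W h(\hat{\boldsymbol s})$. The parametrization is $\tilde{\boldsymbol q}=g_{\boldsymbol V,\boldsymbol W}$, with component functions $\tilde q_1,\dots,\tilde q_N$. Greedy construction: given a data matrix $\boldsymbol S=[\boldsymbol s_1,\dots,\boldsymbol s_M]\in\mathbb{R}^{N\times M}$, the greedy method provides a matrix $\boldsymbol V\in\mathbb{R}^{N\times n}$ with orthonormal columns selected among the left-singular vectors of $\boldsymbol S$ (the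 selection may take both leading and later singular vectors). The matrix $\boldsymbol W$ is then obtained by regularized least-squares regression with a regularization parameter $\gamma>0$, $$\boldsymbol W=\operatorname*{arg\,min}_{\boldsymbol W\in\mathbb{R}^{N\times n^2}}\left\|\boldsymbol V\boldsymbol V^\top\boldsymbol S-\boldsymbol S+\boldsymbol W h(e_{\boldsymbol V}(\boldsymbol S))\right\|_F^2+\gamma\|\boldsymbol W\|_F^2,$$ where $e_{\boldsymbol V}$ and $h$ act column-wise. Matrices constructed in this way satisfy $\boldsymbol V^\top\boldsymbol V=\boldsymbol I$ and $\boldsymbol V^\top\boldsymbol W=\boldsymbol 0$. *)

theory Defs
  imports "HOL-Analysis.Analysis"
begin

text \<open>
  Conventions: an \<open>m \<times> n\<close> matrix has type \<^typ>\<open>real^'n^'m\<close>. The index set of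
  \<open>\<real>\<^sup>n \<otimes> \<real>\<^sup>n\<close>, of size \<open>n\<^sup>2\<close>, is the product type \<^typ>\<open>'n \<times> 'n\<close>: the entry at \<open>(i, j)\<close>
  stands for position \<open>(i - 1) n + j\<close> of the Kronecker product. The library norm on
  \<^typ>\<open>real^'n^'m\<close> is the Frobenius norm, as it is the Euclidean norm of the
  Euclidean norms of the rows.
\<close>

definition feature_map :: "real^'n \<Rightarrow> real^('n::finite \<times> 'n)" where
  "feature_map s = (\<chi> p. s $ fst p * s $ snd p)"

definition encoder :: "real^'N \<Rightarrow> real^'n^'N \<Rightarrow> real^'N \<Rightarrow> real^'n" where
  "encoder s0 V s = transpose V *v (s - s0)"

definition decoder ::
  "real^'N \<Rightarrow> real^'n^'N \<Rightarrow> real^('n::finite \<times> 'n)^'N \<Rightarrow> real^'n \<Rightarrow> real^'N" where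
  "decoder s0 V W \<theta> = s0 + V *v \<theta> + W *v feature_map \<theta>"

definition map_columns :: "(real^'a \<Rightarrow> real^'b) \<Rightarrow> real^'M^'a \<Rightarrow> real^'M^'b" where
  "map_columns \<phi> A = (\<chi> i k. \<phi> (column k A) $ i)"

text \<open>
  Finite index types carry no order, so the diagonal and the decreasing order of the singular
  values refer to some enumerations \<open>a\<close> and \<open>b\<close> of the row and column indices. The
  decomposition is the full one, so it has \<open>N\<close> left-singular vectors; those of a thin
  decomposition are among them.
\<close>

definition singular_value_matrix :: "real^'M^'N \<Rightarrow> bool" where
  "singular_value_matrix \<Sigma> \<longleftrightarrow>
     (\<exists>(a :: 'N \<Rightarrow> nat) (b :: 'M \<Rightarrow> nat) (\<sigma> :: nat \<Rightarrow> real).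
        bij_betw a UNIV {..<CARD('N)} \<and> bij_betw b UNIV {..<CARD('M)} \<and>
        antimono \<sigma> \<and> (\<forall>k. 0 \<le> \<sigma> k) \<and>
        (\<forall>i j. \<Sigma> $ i $ j = (if a i = b j then \<sigma> (a i) else 0)))"

definition is_svd :: "real^'M^'N \<Rightarrow> real^'N^'N \<Rightarrow> real^'M^'N \<Rightarrow> real^'M^'M \<Rightarrow> bool" where
  "is_svd S U \<Sigma> Z \<longleftrightarrow>
     orthogonal_matrix U \<and> singular_value_matrix \<Sigma> \<and> orthogonal_matrix Z \<and>
     S = U ** \<Sigma> ** transpose Z"

text \<open>The selection \<open>\<nu>\<close> of left-singular vectors is arbitrary; in particular it covers every
  outcome of a greedy selection.\<close>

definition selected_left_singular :: "real^'M^'N \<Rightarrow> real^'n^'N \<Rightarrow> bool" where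
  "selected_left_singular S V \<longleftrightarrow>
     (\<exists>U \<Sigma> Z. is_svd S U \<Sigma> Z \<and>
        (\<exists>\<nu> :: 'n \<Rightarrow> 'N. inj \<nu> \<and> (\<forall>j. column j V = column (\<nu> j) U)))"

definition regression_loss ::
  "real \<Rightarrow> real^'N \<Rightarrow> real^'M^'N \<Rightarrow> real^'n^'N \<Rightarrow> real^('n::finite \<times> 'n)^'N \<Rightarrow> real" where
  "regression_loss \<gamma> s0 S V W =
     (norm (V ** transpose V ** S - S
        + W ** map_columns feature_map (map_columns (encoder s0 V) S)))\<^sup>2
     + \<gamma> * (norm W)\<^sup>2"

definition greedy_construction ::
  "real \<Rightarrow> real^'N \<Rightarrow> real^'M^'N \<Rightarrow> real^'n^'N \<Rightarrow> real^('n::finite \<times> 'n)^'N \<Rightarrow> bool" where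
  "greedy_construction \<gamma> s0 S V W \<longleftrightarrow>
     selected_left_singular S V \<and>
     is_arg_min (regression_loss \<gamma> s0 S V) (\<lambda>_. True) W"

text \<open>
  The library's \<^const>\<open>jacobian\<close> is defined from the Frechet derivative; the next two lemmas
  show that for the decoder it is the matrix of partial derivatives.
\<close>

lemma decoder_differentiable:
  fixes V :: "real^'n::finite^'N"
  shows "decoder s0 V W differentiable (at \<theta>)"
proof -
  have "(feature_map :: real^'n \<Rightarrow> _) differentiable (at \<theta>)"
  proof (rule iffD2[OF differentiable_componentwise_within], rule ballI)
    fix u :: "real^('n::finite \<times> 'n)"
    assume "u \<in> Basis"
    then obtain p where "u = axis p 1"
      by (auto simp: Basis_vec_def)
    then show "(\<lambda>x. feature_map x \<bullet> u) differentiable (at \<theta>)"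
      by (simp add: feature_map_def inner_axis differentiable_mult
          bounded_linear_imp_differentiable[OF bounded_linear_vec_nth])
  qed
  then have "(\<lambda>x. W *v feature_map x) differentiable (at \<theta>)"
    by (rule differentiable_compose[rotated])
       (rule bounded_linear_imp_differentiable[OF matrix_vector_mul_bounded_linear])
  moreover have "(\<lambda>x. V *v x) differentiable (at \<theta>)"
    by (rule bounded_linear_imp_differentiable[OF matrix_vector_mul_bounded_linear])
  ultimately show ?thesis
    unfolding decoder_def[abs_def]
    by (intro differentiable_add differentiable_const)
qed

lemma jacobian_decoder_partial:
  "((\<lambda>t. decoder s0 V W (\<theta> + t *\<^sub>R axis j 1) $ i) has_real_derivative
     jacobian (decoder s0 V W) (at \<theta>) $ i $ j) (at 0)"
proof -
  let ?q = "decoder s0 V W" and ?J = "jacobian (decoder s0 V W) (at \<theta>)"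
  have q: "(?q has_derivative (\<lambda>h. ?J *v h)) (at (\<theta> + 0 *\<^sub>R axis j 1))"
    using decoder_differentiable[of s0 V W \<theta>] by (simp add: jacobian_works)
  have l: "((\<lambda>t. \<theta> + t *\<^sub>R axis j (1::real)) has_derivative (\<lambda>t. t *\<^sub>R axis j 1)) (at 0)"
    by (auto intro!: derivative_eq_intros)
  have "((\<lambda>t. ?q (\<theta> + t *\<^sub>R axis j 1)) has_derivative (\<lambda>t. ?J *v (t *\<^sub>R axis j 1))) (at 0)"
    by (rule has_derivative_compose[OF l q])
  from bounded_linear.has_derivative[OF bounded_linear_vec_nth this, of i]
  have "((\<lambda>t. ?q (\<theta> + t *\<^sub>R axis j 1) $ i) has_derivative
      (\<lambda>t. (?J *v (t *\<^sub>R axis j 1)) $ i)) (at 0)" .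
  moreover have "(\<lambda>t. (?J *v (t *\<^sub>R axis j 1)) $ i) = (*) (?J $ i $ j)"
    by (rule ext) (simp only: matrix_vector_mult_scaleR matrix_vector_mult_basis column_def
        vector_scaleR_component vec_lambda_beta real_scaleR_def mult.commute)
  ultimately show ?thesis
    by (simp only: has_field_derivative_def)
qed

end

theory Submission
  imports Defs
begin

text \<open>
  The encoder is a left inverse of the decoder. Since \<open>V\<^sup>T V = I\<close> and \<open>V\<^sup>T W = 0\<close>, the map
  \<open>\<theta> \<mapsto> V\<^sup>T (s\<^sub>0 + V \<theta> + W (\<theta> \<otimes> \<theta>) - s\<^sub>0)\<close> is the identity, and the chain rule gives
  \<open>V\<^sup>T J(\<theta>) = I\<close> for the Jacobian \<open>J\<close> of the decoder (\<open>jacobian_left_inverse\<close>). So \<open>J(\<theta>)\<close> is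
  injective, which is full column rank. For an injective matrix the least-squares problem asks
  for the point of the column space closest to the right-hand side; that point exists and is
  unique, and so is its preimage (\<open>least_squares_unique\<close>).

  It remains to derive the two identities from the construction. The columns of \<open>V\<close> are distinct
  columns of an orthogonal matrix, so \<open>V\<^sup>T V = I\<close>. For \<open>V\<^sup>T W = 0\<close>
  (\<open>transpose_mult_arg_min_regression_loss\<close>), the regression target \<open>S - V V\<^sup>T S\<close> is orthogonal to
  the range of \<open>V\<close>, so a component of \<open>W\<close> in that range cannot improve the fit, while the
  regularization term charges for it; a minimizer has no such component.
\<close>

section \<open>Matrix algebra and orthogonality in the Frobenius inner product\<close>

lemma inner_matrix_mult_left:
  fixes A :: "real^'n^'m" and B :: "real^'k^'n" and C :: "real^'k^'m"
  shows "(A ** B) \<bullet> C = B \<bullet> (transpose A ** C)"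
proof -
  have "(A ** B) \<bullet> C = (\<Sum>i\<in>UNIV. \<Sum>k\<in>UNIV. \<Sum>j\<in>UNIV. A $ i $ j * B $ j $ k * C $ i $ k)"
    by (simp add: inner_vec_def matrix_matrix_mult_def sum_distrib_right)
  also have "\<dots> = (\<Sum>i\<in>UNIV. \<Sum>j\<in>UNIV. \<Sum>k\<in>UNIV. A $ i $ j * B $ j $ k * C $ i $ k)"
    by (intro sum.cong refl sum.swap)
  also have "\<dots> = (\<Sum>j\<in>UNIV. \<Sum>i\<in>UNIV. \<Sum>k\<in>UNIV. A $ i $ j * B $ j $ k * C $ i $ k)"
    by (rule sum.swap)
  also have "\<dots> = (\<Sum>j\<in>UNIV. \<Sum>k\<in>UNIV. \<Sum>i\<in>UNIV. A $ i $ j * B $ j $ k * C $ i $ k)"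
    by (intro sum.cong refl sum.swap)
  also have "\<dots> = B \<bullet> (transpose A ** C)"
    by (simp add: inner_vec_def matrix_matrix_mult_def transpose_def sum_distrib_left ac_simps)
  finally show ?thesis .
qed

lemma matrix_sub_ldistrib:
  fixes A :: "'a::ring_1^'n^'m"
  shows "A ** (B - C) = A ** B - A ** C"
  by (simp add: vec_eq_iff matrix_matrix_mult_def right_diff_distrib sum_subtractf)

lemma matrix_add_rdistrib:
  fixes A B :: "'a::semiring_1^'n^'m"
  shows "(A + B) ** C = A ** C + B ** C"
  by (simp add: vec_eq_iff matrix_matrix_mult_def distrib_right sum.distrib)

lemma norm_add_mult_Pythagorean:
  fixes V :: "real^'n^'N" and B :: "real^'k^'n" and C :: "real^'k^'N"
  assumes "transpose V ** C = 0"
  shows "(norm (C + V ** B))\<^sup>2 = (norm C)\<^sup>2 + (norm (V ** B))\<^sup>2"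
proof -
  have "orthogonal C (V ** B)"
    using assms by (simp add: orthogonal_def inner_commute[of C] inner_matrix_mult_left)
  then show ?thesis
    by (rule norm_add_Pythagorean)
qed

section \<open>The matrices of the greedy construction\<close>

lemma selected_left_singular_orthonormal:
  fixes V :: "real^'n^'N"
  assumes "selected_left_singular S V"
  shows "transpose V ** V = mat 1"
proof -
  obtain U :: "real^'N^'N" and \<nu> :: "'n \<Rightarrow> 'N"
    where U: "orthogonal_matrix U" and \<nu>: "inj \<nu>" "\<And>j. column j V = column (\<nu> j) U"
    using assms unfolding selected_left_singular_def is_svd_def by blast
  have V: "V $ i $ j = U $ i $ \<nu> j" for i j
    using \<nu>(2)[of j] by (simp add: column_def vec_eq_iff)
  have "(transpose V ** V) $ i $ j = (transpose U ** U) $ \<nu> i $ \<nu> j" for i j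
    by (simp add: matrix_matrix_mult_def transpose_def V)
  also have "(transpose U ** U) $ \<nu> i $ \<nu> j = (mat 1 :: real^'n^'n) $ i $ j" for i j
    using U \<nu>(1) by (simp add: orthogonal_matrix mat_def inj_eq)
  finally show ?thesis
    by (simp add: vec_eq_iff)
qed

text \<open>
  Split \<open>W = W\<^sub>0 + V C\<close> with \<open>C = V\<^sup>T W\<close>, so that \<open>V\<^sup>T W\<^sub>0 = 0\<close>. By Pythagoras, applied to the
  residual and to the regularization term, the loss at \<open>W\<close> exceeds the loss at \<open>W\<^sub>0\<close> by at least
  \<open>\<gamma> \<parallel>V C\<parallel>\<^sup>2\<close>, and minimality forces \<open>V C = 0\<close>.
\<close>
lemma transpose_mult_arg_min_regression_loss:
  fixes S :: "real^'M^'N" and V :: "real^'n^'N" and W :: "real^('n \<times> 'n)^'N"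
  assumes V: "transpose V ** V = mat 1" and \<gamma>: "\<gamma> > 0"
    and min: "is_arg_min (regression_loss \<gamma> s0 S V) (\<lambda>_. True) W"
  shows "transpose V ** W = 0"
proof -
  define H where "H = map_columns feature_map (map_columns (encoder s0 V) S)"
  define C where "C = transpose V ** W"
  define W0 where "W0 = W - V ** C"
  define R0 where "R0 = V ** transpose V ** S - S + W0 ** H"
  have VV: "transpose V ** (V ** X) = X" for X :: "real^'k^'n"
    by (simp add: matrix_mul_assoc V)
  have W0: "transpose V ** W0 = 0"
    by (simp add: W0_def matrix_sub_ldistrib VV C_def)
  have R0: "transpose V ** R0 = 0"
    by (simp add: R0_def matrix_add_ldistrib matrix_sub_ldistrib matrix_mul_assoc V W0)
  have W: "W = W0 + V ** C"
    by (simp add: W0_def)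
  have R: "V ** transpose V ** S - S + W ** H = R0 + V ** (C ** H)"
    unfolding R0_def by (subst W) (simp add: matrix_add_rdistrib matrix_mul_assoc)
  have "regression_loss \<gamma> s0 S V W =
      (norm (R0 + V ** (C ** H)))\<^sup>2 + \<gamma> * (norm (W0 + V ** C))\<^sup>2"
    unfolding regression_loss_def H_def[symmetric] R by (simp flip: W)
  also have "\<dots> = regression_loss \<gamma> s0 S V W0
      + (norm (V ** (C ** H)))\<^sup>2 + \<gamma> * (norm (V ** C))\<^sup>2"
    unfolding regression_loss_def H_def[symmetric] R0_def[symmetric]
    by (simp add: norm_add_mult_Pythagorean R0 W0 distrib_left)
  finally have "\<gamma> * (norm (V ** C))\<^sup>2 \<le> regression_loss \<gamma> s0 S V W - regression_loss \<gamma> s0 S V W0"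
    by simp
  also have "\<dots> \<le> 0"
    using min by (simp add: is_arg_min_def not_less)
  finally have "V ** C = 0"
    using \<gamma> by (simp add: mult_le_0_iff)
  then have "C = 0"
    using VV[of C] by simp
  then show ?thesis
    by (simp add: C_def)
qed

section \<open>The Jacobian of the decoder\<close>

lemma encoder_decoder:
  fixes V :: "real^'n^'N"
  assumes "transpose V ** V = mat 1" and "transpose V ** W = 0"
  shows "encoder s0 V (decoder s0 V W \<theta>) = \<theta>"
  using assms
  by (simp add: encoder_def decoder_def matrix_vector_right_distrib matrix_vector_mul_assoc)

lemma jacobian_left_inverse:
  fixes V :: "real^'n^'N"
  assumes "transpose V ** V = mat 1" and "transpose V ** W = 0"
  shows "transpose V ** jacobian (decoder s0 V W) (at \<theta>) = mat 1"
proof -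
  let ?J = "jacobian (decoder s0 V W) (at \<theta>)"
  have "(decoder s0 V W has_derivative (\<lambda>h. ?J *v h)) (at \<theta>)"
    using decoder_differentiable[of s0 V W \<theta>] by (simp add: jacobian_works)
  then have "((\<lambda>x. encoder s0 V (decoder s0 V W x)) has_derivative
      (\<lambda>h. transpose V *v (?J *v h - 0))) (at \<theta>)"
    unfolding encoder_def
    by (intro bounded_linear.has_derivative[OF matrix_vector_mul_bounded_linear]
        has_derivative_diff has_derivative_const)
  then have "((\<lambda>x. x) has_derivative (\<lambda>h. transpose V *v (?J *v h - 0))) (at \<theta>)"
    by (simp only: encoder_decoder[OF assms])
  then have "(\<lambda>h. transpose V *v (?J *v h - 0)) = (\<lambda>h. h)"
    using has_derivative_ident has_derivative_unique by blast
  then have "(transpose V ** ?J) *v h = mat 1 *v h" for h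
    by (simp add: fun_eq_iff matrix_vector_mul_assoc)
  then show ?thesis
    by (simp add: matrix_eq)
qed

section \<open>Linear least squares\<close>

lemma least_squares_unique:
  fixes A :: "real^'n^'m"
  assumes inj: "inj ((*v) A)"
  shows "\<exists>!x. is_arg_min (\<lambda>x. (norm (A *v x - b))\<^sup>2) (\<lambda>_. True) x"
proof -
  let ?R = "range ((*v) A)"
  have R: "closed ?R" "convex ?R" "?R \<noteq> {}"
    by (auto intro!: closed_subspace subspace_imp_convex linear_subspace_image)
  have arg_min_iff: "is_arg_min (\<lambda>x. (norm (A *v x - b))\<^sup>2) (\<lambda>_. True) x \<longleftrightarrow>
      A *v x = closest_point ?R b" for x
  proof -
    have "is_arg_min (\<lambda>x. (norm (A *v x - b))\<^sup>2) (\<lambda>_. True) x \<longleftrightarrow>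
        (\<forall>z\<in>?R. dist b (A *v x) \<le> dist b z)"
      by (simp add: is_arg_min_linorder dist_norm norm_minus_commute)
    also have "\<dots> \<longleftrightarrow> A *v x = closest_point ?R b"
      using closest_point_unique[OF R(2,1)] closest_point_le[OF R(1)] by (metis rangeI)
    finally show ?thesis .
  qed
  obtain x where "closest_point ?R b = A *v x"
    using closest_point_in_set[OF R(1,3)] by blast
  then show ?thesis
    unfolding arg_min_iff using inj by (auto dest: injD)
qed

section \<open>Full column rank and unique solvability\<close>

theorem mainTheorem1:
  fixes S :: "real^'M^'N"
    and V :: "real^'n^'N"
    and W :: "real^('n \<times> 'n)^'N"
    and s0 :: "real^'N"
    and \<gamma> :: real
    and D :: "(real^'d) set"
    and f :: "real^'N \<Rightarrow> real^'d \<Rightarrow> real^'N"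
  assumes "CARD('n) < CARD('N)"
    and "\<gamma> > 0"
    and "greedy_construction \<gamma> s0 S V W"
  shows "(\<forall>\<theta>. rank (jacobian (decoder s0 V W) (at \<theta>)) = CARD('n)) \<and>
    (\<forall>\<theta>. \<forall>\<mu>\<in>D. \<exists>!\<eta>. is_arg_min
      (\<lambda>\<eta>. (norm (jacobian (decoder s0 V W) (at \<theta>) *v \<eta> - f (decoder s0 V W \<theta>) \<mu>))\<^sup>2)
      (\<lambda>_. True) \<eta>)"
proof -
  have V: "transpose V ** V = mat 1"
    using assms(3) selected_left_singular_orthonormal by (auto simp: greedy_construction_def)
  have W: "transpose V ** W = 0"
    using assms(3) transpose_mult_arg_min_regression_loss[OF V assms(2)]
    unfolding greedy_construction_def by blast
  have inj: "inj ((*v) (jacobian (decoder s0 V W) (at \<theta>)))" for \<theta>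
    using jacobian_left_inverse[OF V W] by (metis matrix_left_invertible_injective)
  then show ?thesis
    by (simp add: full_rank_injective least_squares_unique)
qed

end
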